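(* Let $\mathcal{Z}$ be a finite set, $E=\prod_{z\in\mathcal{Z}}(L_z,U_z)$ a product of $|\mathcal{Z}|$ intervals of the real line, and let $Q:E\to\mathbb{R}^{|\mathcal{Z}|}$ be a continuous function such that $\sum_{z\in\mathcal{Z}}Q_z(p)=c$ for all $p\in E$, for some $c\in\mathbb{R}$. Assume $Q$ satisfies weak substitutes and connected strict substitutes. Let $q\in\mathbb{R}^{|\mathcal{Z}|}$ with $\sum_{z\in\mathcal{Z}}q_z=c$. Let $\psi:\mathbb{R}^{|\mathcal{Z}|}\to\mathbb{R}$ be a normalization mapping (with bounds $L_\psi,U_\psi$), and assume that $p_z<p_z'$ for all $z\in\mathcal{Z}$ implies $\psi(p)<\psi(p')$. Then, for any $K\in(L_\psi,U_\psi)$, the system $$Q(p)=q,\qquad \psi(p)=K$$ has at most one solution $p\in E$.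
   Context: Weak substitutes: for all $x\ne y$ in $\mathcal{Z}$, $Q_x(p)$ is nondecreasing in $p_x$ and nonincreasing in $p_y$. Connected strict substitutes: for every nonempty set $\mathcal{X}\subset\mathcal{Z}$ and all $p,p'\in E$, if $p_x=p'_x$ for $x\in\mathcal{X}$, $p_y\le p'_y$ for $y\notin\mathcal{X}$, and $p\ne p'$, then $\sum_{x\in\mathcal{X}}Q_x(p)>\sum_{x\in\mathcal{X}}Q_x(p')$. Normalization mapping: $\psi:\mathbb{R}^{|\mathcal{Z}|}\to\mathbb{R}$ (i) is continuous; (ii) is weakly increasing in $p_z$ for all $z\in\mathcal{Z}$; (iii) satisfies $\psi(p)\to L_\psi$ when $p_z\to L_z$ for all $z\in\mathcal{Z}$; (iv) satisfies $\psi(p)\to U_\psi$ when $p_z\to U_z$ for all $z\in\mathcal{Z}$; (v) satisfies $\psi(p+t1_{\mathcal{Z}})=\psi(p)+t$ for all $t\in\mathbb{R}$, where $1_{\mathcal{Z}}$ is the all-ones vector. Bounds may be infinite. *)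

theory Defs
  imports "HOL-Analysis.Analysis"
begin

definition price_box :: "('z::finite \<Rightarrow> ereal) \<Rightarrow> ('z \<Rightarrow> ereal) \<Rightarrow> (real ^ 'z) set" where
  "price_box L U = {p. \<forall>z. L z < ereal (p $ z) \<and> ereal (p $ z) < U z}"

definition nondecreasing_in :: "'z::finite \<Rightarrow> (real ^ 'z) set \<Rightarrow> (real ^ 'z \<Rightarrow> real) \<Rightarrow> bool" where
  "nondecreasing_in z S f \<longleftrightarrow>
     (\<forall>p\<in>S. \<forall>p'\<in>S. (\<forall>y. y \<noteq> z \<longrightarrow> p $ y = p' $ y) \<longrightarrow> p $ z \<le> p' $ z \<longrightarrow> f p \<le> f p')"

definition nonincreasing_in :: "'z::finite \<Rightarrow> (real ^ 'z) set \<Rightarrow> (real ^ 'z \<Rightarrow> real) \<Rightarrow> bool" where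
  "nonincreasing_in z S f \<longleftrightarrow>
     (\<forall>p\<in>S. \<forall>p'\<in>S. (\<forall>y. y \<noteq> z \<longrightarrow> p $ y = p' $ y) \<longrightarrow> p $ z \<le> p' $ z \<longrightarrow> f p' \<le> f p)"

definition weak_substitutes :: "(real ^ 'z::finite) set \<Rightarrow> (real ^ 'z \<Rightarrow> real ^ 'z) \<Rightarrow> bool" where
  "weak_substitutes E Q \<longleftrightarrow>
     (\<forall>x y. x \<noteq> y \<longrightarrow>
        nondecreasing_in x E (\<lambda>p. Q p $ x) \<and> nonincreasing_in y E (\<lambda>p. Q p $ x))"

definition connected_strict_substitutes ::
    "(real ^ 'z::finite) set \<Rightarrow> (real ^ 'z \<Rightarrow> real ^ 'z) \<Rightarrow> bool" where
  "connected_strict_substitutes E Q \<longleftrightarrow>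
     (\<forall>X. X \<noteq> {} \<longrightarrow>
        (\<forall>p\<in>E. \<forall>p'\<in>E.
           (\<forall>x\<in>X. p $ x = p' $ x) \<longrightarrow> (\<forall>y. y \<notin> X \<longrightarrow> p $ y \<le> p' $ y) \<longrightarrow> p \<noteq> p' \<longrightarrow>
           (\<Sum>x\<in>X. Q p $ x) > (\<Sum>x\<in>X. Q p' $ x)))"

text \<open>
  The filter of vectors \<open>p\<close> with \<open>p $ z \<longlongrightarrow> b z\<close> for every \<open>z\<close>. The limits are taken
  in the extended reals, as components of \<open>b\<close> may be infinite, and \<open>p\<close> ranges over the whole
  space rather than over a box with corner \<open>b\<close>.
\<close>

definition coords_to :: "('z::finite \<Rightarrow> ereal) \<Rightarrow> (real ^ 'z) filter" where
  "coords_to b = (INF z. filtercomap (\<lambda>p. ereal (p $ z)) (nhds (b z)))"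

definition normalization_mapping ::
    "('z::finite \<Rightarrow> ereal) \<Rightarrow> ('z \<Rightarrow> ereal) \<Rightarrow> ereal \<Rightarrow> ereal \<Rightarrow> (real ^ 'z \<Rightarrow> real) \<Rightarrow> bool" where
  "normalization_mapping L U L\<^sub>\<psi> U\<^sub>\<psi> \<psi> \<longleftrightarrow>
     continuous_on UNIV \<psi> \<and>
     (\<forall>z. nondecreasing_in z UNIV \<psi>) \<and>
     ((\<lambda>p. ereal (\<psi> p)) \<longlongrightarrow> L\<^sub>\<psi>) (coords_to L) \<and>
     ((\<lambda>p. ereal (\<psi> p)) \<longlongrightarrow> U\<^sub>\<psi>) (coords_to U) \<and>
     (\<forall>p t. \<psi> (p + t *\<^sub>R 1) = \<psi> p + t)"

end

theory Submission
  imports Defs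
begin

text \<open>
  The componentwise minimum \<open>r\<close> of two solutions \<open>p\<close>, \<open>p'\<close> lies in the box, and every coordinate
  of \<open>r\<close> agrees with \<open>p\<close> or with \<open>p'\<close>. If \<open>r\<close> differed from both, connected strict substitutes
  for singletons would give \<open>Q\<^sub>x r > q\<^sub>x\<close> for every \<open>x\<close>, against the constant sum of \<open>Q\<close>. So two
  solutions are ordered; connected strict substitutes for the set of coordinates on which they
  agree then shows that they are strictly ordered in every coordinate or equal. Strictly ordered
  solutions have different values of \<open>\<psi>\<close>.
\<close>

lemma price_box_min:
  assumes "p \<in> price_box L U" and "p' \<in> price_box L U"
  shows "(\<chi> z. min (p $ z) (p' $ z)) \<in> price_box L U"
  using assms by (auto simp: price_box_def min_def)

lemma connected_strict_substitutesD:
  assumes "connected_strict_substitutes E Q" and "X \<noteq> {}" and "p \<in> E" and "p' \<in> E"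
    and "\<And>x. x \<in> X \<Longrightarrow> p $ x = p' $ x" and "\<And>z. p $ z \<le> p' $ z" and "p \<noteq> p'"
  shows "(\<Sum>x\<in>X. Q p' $ x) < (\<Sum>x\<in>X. Q p $ x)"
  using assms unfolding connected_strict_substitutes_def by blast

text \<open>A nonempty agreement set can serve as \<open>X\<close>: the sum of \<open>Q\<close> over
  it would be larger at \<open>p\<close> than at \<open>p'\<close>.\<close>

lemma ordered_preimages_strict:
  assumes css: "connected_strict_substitutes E Q"
    and E: "p \<in> E" "p' \<in> E" and le: "\<And>z. p $ z \<le> p' $ z"
    and ne: "p \<noteq> p'" and eq: "Q p = Q p'"
  shows "p $ z < p' $ z"
proof (rule ccontr)
  assume "\<not> p $ z < p' $ z"
  with le[of z] have "{x. p $ x = p' $ x} \<noteq> {}" by (auto intro: antisym)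
  from connected_strict_substitutesD[OF css this E _ le ne] eq show False by simp
qed

text \<open>Closure of \<open>E\<close> under componentwise minimum is what allows evaluating the
  hypotheses on \<open>Q\<close> at the meet of two preimages.\<close>

lemma strictly_comparable_preimages:
  fixes Q :: "real ^ 'z::finite \<Rightarrow> real ^ 'z"
  assumes css: "connected_strict_substitutes E Q"
    and min_closed: "\<And>p p'. p \<in> E \<Longrightarrow> p' \<in> E \<Longrightarrow> (\<chi> z. min (p $ z) (p' $ z)) \<in> E"
    and const: "\<And>p. p \<in> E \<Longrightarrow> (\<Sum>z\<in>UNIV. Q p $ z) = c"
    and E: "p \<in> E" "p' \<in> E" and eq: "Q p = Q p'" and ne: "p \<noteq> p'"
  shows "(\<forall>z. p $ z < p' $ z) \<or> (\<forall>z. p' $ z < p $ z)"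
proof -
  define r where "r = (\<chi> z. min (p $ z) (p' $ z))"
  have r: "r \<in> E" using min_closed[OF E] by (simp add: r_def)
  have "r = p \<or> r = p'"
  proof (rule ccontr)
    assume "\<not> (r = p \<or> r = p')"
    then have rne: "r \<noteq> p" "r \<noteq> p'" by auto
    \<comment> \<open>\<open>r\<close> lies below both points and agrees at \<open>x\<close> with
      the one smaller there; by \<open>eq\<close> either comparison bounds
      \<open>Q p $ x\<close>.\<close>
    have "Q p $ x < Q r $ x" for x
    proof (cases "p $ x \<le> p' $ x")
      case True
      then show ?thesis
        using connected_strict_substitutesD[OF css, of "{x}" r p] r E rne by (auto simp: r_def)
    next
      case False
      then show ?thesis
        using connected_strict_substitutesD[OF css, of "{x}" r p'] r E rne eq
        by (auto simp: r_def)
    qed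
    \<comment> \<open>Strictness survives summation since \<open>UNIV\<close> is finite and
      nonempty.\<close>
    then have "(\<Sum>x\<in>UNIV. Q p $ x) < (\<Sum>x\<in>UNIV. Q r $ x)"
      by (intro sum_strict_mono) auto
    with const[OF r] const[OF E(1)] show False by simp
  qed
  then consider "\<And>z. p $ z \<le> p' $ z" | "\<And>z. p' $ z \<le> p $ z"
    by (metis r_def vec_lambda_beta min.cobounded1 min.cobounded2)
  then show ?thesis
    using ordered_preimages_strict[OF css] E ne eq by cases metis+
qed

theorem corollary1:
  fixes L U :: "'z::finite \<Rightarrow> ereal"
    and E :: "(real ^ 'z) set"
    and Q :: "real ^ 'z \<Rightarrow> real ^ 'z"
    and q :: "real ^ 'z"
    and \<psi> :: "real ^ 'z \<Rightarrow> real"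
    and L\<^sub>\<psi> U\<^sub>\<psi> :: ereal
    and c K :: real
  assumes "E = price_box L U"
    and "continuous_on E Q"
    and "\<And>p. p \<in> E \<Longrightarrow> (\<Sum>z\<in>UNIV. Q p $ z) = c"
    and "weak_substitutes E Q"
    and "connected_strict_substitutes E Q"
    and "(\<Sum>z\<in>UNIV. q $ z) = c"
    and "normalization_mapping L U L\<^sub>\<psi> U\<^sub>\<psi> \<psi>"
    and "\<And>p p'. (\<And>z. p $ z < p' $ z) \<Longrightarrow> \<psi> p < \<psi> p'"
    and "L\<^sub>\<psi> < ereal K" and "ereal K < U\<^sub>\<psi>"
  shows "\<exists>\<^sub>\<le>\<^sub>1 p. p \<in> E \<and> Q p = q \<and> \<psi> p = K"
proof (rule Uniq_I)
  fix p p'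
  assume p: "p \<in> E \<and> Q p = q \<and> \<psi> p = K" and p': "p' \<in> E \<and> Q p' = q \<and> \<psi> p' = K"
  show "p = p'"
  proof (rule ccontr)
    assume "p \<noteq> p'"
    then have "(\<forall>z. p $ z < p' $ z) \<or> (\<forall>z. p' $ z < p $ z)"
      using p p' assms(1,3) price_box_min
      by (intro strictly_comparable_preimages[OF assms(5)]) auto
    then have "\<psi> p < \<psi> p' \<or> \<psi> p' < \<psi> p"
      using assms(8) by blast
    with p p' show False by simp
  qed
qed

end
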